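(* Let $\Lambda=\{\lambda_n\}_{n\ge 1}$ be a sequence of real numbers with $1<\lambda_1\le\lambda_2\le\cdots$, $\lim_{n\to\infty}\lambda_n=\infty$ and $\sum_{n=1}^{\infty}1/\lambda_n=+\infty$. Let $\{p(n)\}_{n\ge1}$ be an increasing sequence of real numbers with $p(n)\ge 1$ for all $n$ and $p(n)\to\infty$ as $n\to\infty$. Then there exists a function $f\in BV^{\#}(p(n)\uparrow\infty)\cap C(I^2)$ such that $f\notin\Lambda^{\#}BV$.
   Context: All functions $f$ are real-valued measurable functions on $\mathbb{R}^2$ that are $1$-periodic in each variable. Let $I=[0,1]$ and $I^2=[0,1]\times[0,1]$; $f\in C(I^2)$ means that $f$ is continuous on $I^2$. For an interval $J$ with endpoints $a<b$ and a point $x$ or $y$, put $f(J,y)=f(b,y)-f(a,y)$ and $f(x,J)=f(x,b)-f(x,a)$. Class $\Lambda^{\#}BV$: let $\Omega$ be the set of all (finite or countable) collections $\{I_i\}$ of nonoverlapping subintervals of $I$, indexed in arbitrary order. Define $$\Lambda^{\#}V_1(f)=\sup_{\{y_i\}\subset I}\ \sup_{\{I_i\}\in\Omega}\ \sum_i\frac{|f(I_i,y_i)|}{\lambda_i},\qquad \Lambda^{\#}V_2(f)=\sup_{\{x_j\}\subset I}\ \sup_{\{J_j\}\in\Omega}\ \sum_j\frac{|f(x_j,J_j)|}{\lambda_j}.$$ Then $f\in\Lambda^{\#}BV$ if $\Lambda^{\#}V_1(f)+\Lambda^{\#}V_2(f)<\infty$. Class $BV^{\#}(p(n)\uparrow\infty)$: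 a partition with period $1$ is a strictly increasing doubly infinite sequence $\Delta:\ \cdots<t_{-1}<t_0<t_1<\cdots$ of reals for which there is a positive integer $m$ (depending on $\Delta$) with $t_{k+m}=t_k+1$ for all $k\in\mathbb{Z}$; its intervals are $I_i=(t_{i-1},t_i)$, $i=1,\dots,m$, of length $|I_i|=t_i-t_{i-1}$. Define $$V_1^{\#}(f,p(n)\uparrow\infty)=\sup_{\{y_i\}\subset I}\ \sup_{n\ge1}\ \sup_{\Delta}\Big\{\Big(\sum_{i=1}^{m}|f(I_i,y_i)|^{p(n)}\Big)^{1/p(n)}:\ \inf_i|I_i|\ge 2^{-n}\Big\},$$ $$V_2^{\#}(f,p(n)\uparrow\infty)=\sup_{\{x_j\}\subset I}\ \sup_{n\ge1}\ \sup_{\Delta}\Big\{\Big(\sum_{j=1}^{m}|f(x_j,I_j)|^{p(n)}\Big)^{1/p(n)}:\ \inf_j|I_j|\ge 2^{-n}\Big\},$$ the suprema over $\Delta$ being over all partitions with period $1$ satisfying the stated length condition. Then $f\in BV^{\#}(p(n)\uparrow\infty)$ if both $V_1^{\#}(f,p(n)\uparrow\infty)$ and $V_2^{\#}(f,p(n)\uparrow\infty)$ are finite. *)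

theory Defs
  imports "HOL-Analysis.Analysis"
begin

definition periodic_functions :: "(real \<times> real \<Rightarrow> real) set" where
  "periodic_functions =
     {f \<in> borel_measurable lebesgue. \<forall>x y. f (x + 1, y) = f (x, y) \<and> f (x, y + 1) = f (x, y)}"

definition continuous_on_square :: "(real \<times> real \<Rightarrow> real) set" where
  "continuous_on_square =
     {f \<in> periodic_functions. continuous_on ({0..1} \<times> {0..1}) f}"

(* The increments f(J, y) and f(x, J) depend only on the endpoints of the interval J, so
   a nondegenerate interval is represented throughout by the pair (a, b) of its endpoints, a < b. *)

definition incr1 :: "(real \<times> real \<Rightarrow> real) \<Rightarrow> real \<times> real \<Rightarrow> real \<Rightarrow> real" where
  "incr1 f J y = f (snd J, y) - f (fst J, y)"

definition incr2 :: "(real \<times> real \<Rightarrow> real) \<Rightarrow> real \<Rightarrow> real \<times> real \<Rightarrow> real" where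
  "incr2 f x J = f (x, snd J) - f (x, fst J)"

(* A finite or countable collection is a pair (S, J): the index set S is {1..N} or all positive
   integers, and J i is the i-th interval. The enumeration is arbitrary: the intervals need not
   be listed from left to right. Nonoverlapping means that the interiors are disjoint. *)

definition interval_collections :: "(nat set \<times> (nat \<Rightarrow> real \<times> real)) set" where
  "interval_collections =
     {(S, J). (S = {1..} \<or> (\<exists>N. S = {1..N})) \<and>
        (\<forall>i\<in>S. 0 \<le> fst (J i) \<and> fst (J i) < snd (J i) \<and> snd (J i) \<le> 1) \<and>
        (\<forall>i\<in>S. \<forall>j\<in>S. i \<noteq> j \<longrightarrow>
           {fst (J i)<..<snd (J i)} \<inter> {fst (J j)<..<snd (J j)} = {})}"

definition unit_sequences :: "(nat \<Rightarrow> real) set" where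
  "unit_sequences = {y. range y \<subseteq> {0..1}}"

(* Sequences (lam n), (p n) are indexed by n >= 1; their values at 0 are never used. *)

definition Lambda_V1 :: "(nat \<Rightarrow> real) \<Rightarrow> (real \<times> real \<Rightarrow> real) \<Rightarrow> ennreal" where
  "Lambda_V1 lam f =
     (SUP y\<in>unit_sequences. SUP (S, J)\<in>interval_collections.
        \<Sum>\<^sub>\<infinity>i\<in>S. ennreal (\<bar>incr1 f (J i) (y i)\<bar> / lam i))"

definition Lambda_V2 :: "(nat \<Rightarrow> real) \<Rightarrow> (real \<times> real \<Rightarrow> real) \<Rightarrow> ennreal" where
  "Lambda_V2 lam f =
     (SUP x\<in>unit_sequences. SUP (S, J)\<in>interval_collections.
        \<Sum>\<^sub>\<infinity>j\<in>S. ennreal (\<bar>incr2 f (x j) (J j)\<bar> / lam j))"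

definition Lambda_BV :: "(nat \<Rightarrow> real) \<Rightarrow> (real \<times> real \<Rightarrow> real) set" where
  "Lambda_BV lam = {f \<in> periodic_functions. Lambda_V1 lam f + Lambda_V2 lam f < \<infinity>}"

(* A partition t with period 1 is paired with its (unique) number m of intervals per period. *)

definition periodic_partitions :: "((int \<Rightarrow> real) \<times> nat) set" where
  "periodic_partitions =
     {(t, m). strict_mono t \<and> 1 \<le> m \<and> (\<forall>k. t (k + int m) = t k + 1)}"

definition partition_interval :: "(int \<Rightarrow> real) \<Rightarrow> nat \<Rightarrow> real \<times> real" where
  "partition_interval t i = (t (int i - 1), t (int i))"

definition fine_partitions :: "nat \<Rightarrow> ((int \<Rightarrow> real) \<times> nat) set" where
  "fine_partitions n =
     {(t, m) \<in> periodic_partitions.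
        (INF i\<in>{1..m}. snd (partition_interval t i) - fst (partition_interval t i)) \<ge> 1 / 2 ^ n}"

definition V1_sharp :: "(nat \<Rightarrow> real) \<Rightarrow> (real \<times> real \<Rightarrow> real) \<Rightarrow> ennreal" where
  "V1_sharp p f =
     (SUP y\<in>unit_sequences. SUP n\<in>{1..}. SUP (t, m)\<in>fine_partitions n.
        ennreal ((\<Sum>i=1..m. \<bar>incr1 f (partition_interval t i) (y i)\<bar> powr p n) powr (1 / p n)))"

definition V2_sharp :: "(nat \<Rightarrow> real) \<Rightarrow> (real \<times> real \<Rightarrow> real) \<Rightarrow> ennreal" where
  "V2_sharp p f =
     (SUP x\<in>unit_sequences. SUP n\<in>{1..}. SUP (t, m)\<in>fine_partitions n.
        ennreal ((\<Sum>j=1..m. \<bar>incr2 f (x j) (partition_interval t j)\<bar> powr p n) powr (1 / p n)))"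

definition BV_sharp :: "(nat \<Rightarrow> real) \<Rightarrow> (real \<times> real \<Rightarrow> real) set" where
  "BV_sharp p = {f \<in> periodic_functions. V1_sharp p f < \<infinity> \<and> V2_sharp p f < \<infinity>}"

end

theory Submission
  imports Defs
begin

text \<open>
  The witness depends on \<open>x\<close> only: it is a sum over \<open>k\<close> of combs of height \<open>4^(-k)\<close> with \<open>N k\<close> teeth,
  supported on the disjoint intervals \<open>[2^(-k-1), 2^(-k-1) + 2^(-r k)]\<close>. Choosing \<open>N k\<close> with
  \<open>1/lam 1 + ... + 1/lam (N k) \<ge> 8^k\<close> makes the \<open>k\<close>-th comb alone contribute \<open>2^k\<close> to the
  \<open>Lambda\<close>-variation. A partition with mesh at least \<open>2^(-n)\<close> sees the \<open>k\<close>-th comb through at most two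
  increments if \<open>n < r k\<close>, and otherwise through increments of total size at most its variation
  \<open>pi * N k\<close>; the latter is at most \<open>2 powr p n\<close> once \<open>r k\<close> is so large that
  \<open>pi * N k \<le> 2 powr p (r k)\<close>. Since \<open>p(n)\<close> tends to infinity, such an \<open>r k\<close> exists.
\<close>

section \<open>A single comb and nondecreasing majorants for its increments\<close>

text \<open>The comb has \<open>N\<close> humps on \<open>[0, d]\<close> and vanishes on \<open>[d, 1]\<close>, because \<open>sin (pi * N) = 0\<close>.\<close>
definition comb :: "nat \<Rightarrow> real \<Rightarrow> real \<Rightarrow> real" where
  "comb N d x = \<bar>sin (pi * real N * (min (frac x) d / d))\<bar>"

lemma comb_nonneg: "0 \<le> comb N d x"
  by (simp add: comb_def)

lemma comb_le_1: "comb N d x \<le> 1"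
  by (simp add: comb_def)

lemma comb_diff_le_1: "\<bar>comb N d x - comb N d y\<bar> \<le> 1"
  using comb_nonneg[of N d x] comb_le_1[of N d x] comb_nonneg[of N d y] comb_le_1[of N d y]
  by linarith

lemma comb_periodic: "comb N d (x + 1) = comb N d x"
  by (simp add: comb_def frac_1_eq)

lemma comb_measurable [measurable]: "comb N d \<in> borel_measurable borel"
  unfolding comb_def frac_def by measurable

lemma sin_lipschitz: "\<bar>sin x - sin y\<bar> \<le> \<bar>x - y\<bar>" for x y :: real
proof -
  have "\<bar>sin x - sin y\<bar> = 2 * (\<bar>sin ((x - y) / 2)\<bar> * \<bar>cos ((x + y) / 2)\<bar>)"
    by (simp add: sin_diff_sin abs_mult)
  also have "\<dots> \<le> 2 * (\<bar>(x - y) / 2\<bar> * 1)"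
    by (intro mult_left_mono mult_mono abs_sin_x_le_abs_x) auto
  finally show ?thesis by simp
qed

text \<open>The floor term compensates for the reset of the phase at each integer, so
  \<open>W\<close> is nondecreasing, and \<open>\<bar>sin\<bar>\<close>, being 1-Lipschitz in the
  phase, varies no more than \<open>W\<close>. A bound by a difference of \<open>W\<close>
  telescopes over a partition.\<close>

lemma comb_increment_le_variation:
  fixes N :: nat
  assumes "0 < d" and "a \<le> b"
  defines "W \<equiv> \<lambda>x. pi * real N * (real_of_int \<lfloor>x\<rfloor> + min (frac x) d / d)"
  shows "\<bar>comb N d b - comb N d a\<bar> \<le> W b - W a"
proof -
  define q where "q x = min (frac x) d / d" for x
  have q: "0 \<le> q x" "q x \<le> 1" for x
    using \<open>0 < d\<close> by (auto simp: q_def min_def)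
  have comb: "comb N d x = \<bar>sin (pi * real N * q x)\<bar>" for x
    by (simp add: comb_def q_def)
  have W: "W b - W a = pi * real N * (real_of_int \<lfloor>b\<rfloor> - real_of_int \<lfloor>a\<rfloor> + (q b - q a))"
    by (simp add: W_def q_def algebra_simps)
  have lip: "\<bar>\<bar>sin (pi * real N * u)\<bar> - \<bar>sin (pi * real N * v)\<bar>\<bar> \<le> pi * real N * \<bar>u - v\<bar>" for u v
  proof -
    have "\<bar>\<bar>sin (pi * real N * u)\<bar> - \<bar>sin (pi * real N * v)\<bar>\<bar> \<le> \<bar>pi * real N * u - pi * real N * v\<bar>"
      using sin_lipschitz[of "pi * real N * u" "pi * real N * v"] by linarith
    also have "\<dots> = pi * real N * \<bar>u - v\<bar>"
      by (simp add: abs_mult flip: right_diff_distrib)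
    finally show ?thesis .
  qed
  show ?thesis
  proof (cases "\<lfloor>a\<rfloor> = \<lfloor>b\<rfloor>")
    case True
    then have "frac a \<le> frac b"
      using \<open>a \<le> b\<close> by (simp add: frac_def)
    then have "q a \<le> q b"
      using \<open>0 < d\<close> by (auto simp: q_def intro!: divide_right_mono)
    then show ?thesis
      using lip[of "q b" "q a"] True by (simp add: W comb)
  next
    case False
    then have "\<lfloor>a\<rfloor> + 1 \<le> \<lfloor>b\<rfloor>"
      using floor_mono[OF \<open>a \<le> b\<close>] by linarith
    then have 1: "1 \<le> real_of_int \<lfloor>b\<rfloor> - real_of_int \<lfloor>a\<rfloor>"
      by linarith
    \<comment> \<open>When an integer separates \<open>a\<close> from \<open>b\<close>, the two
      values are bounded separately: the phase at \<open>b\<close> is compared with the zero at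
      \<open>q = 0\<close>, the phase at \<open>a\<close> with the zero at
      \<open>q = 1\<close>.\<close>
    have sin_npi: "sin (pi * real N) = 0"
      by (simp add: mult.commute)
    have "\<bar>comb N d b - comb N d a\<bar> \<le> comb N d b + comb N d a"
      using comb_nonneg[of N d a] comb_nonneg[of N d b] by linarith
    also have "\<dots> \<le> pi * real N * q b + pi * real N * (1 - q a)"
      using lip[of "q b" 0] lip[of 1 "q a"] q[of a] q[of b] by (simp add: comb sin_npi)
    also have "\<dots> = pi * real N * (1 + (q b - q a))"
      by (simp add: algebra_simps)
    also have "\<dots> \<le> W b - W a"
      unfolding W using 1 by (intro mult_left_mono) auto
    finally show ?thesis .
  qed
qed

lemma comb_eq_0:
  assumes "0 < d" and "frac x = 0 \<or> d \<le> frac x"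
  shows "comb N d x = 0"
  using assms by (auto simp: comb_def mult.commute[of pi] simp del: frac_eq_0_iff)

text \<open>
  \<open>W\<close> counts the integer translates of the two endpoints of the support. If \<open>b - a \<ge> d\<close> and one of \<open>a\<close>,
  \<open>b\<close> lies inside a support interval, then an endpoint of it separates \<open>a\<close> from \<open>b\<close>.
\<close>
lemma comb_long_increment:
  assumes "0 < d" and "d \<le> b - a"
  defines "W \<equiv> \<lambda>x. real_of_int \<lfloor>x\<rfloor> + real_of_int \<lfloor>x - d\<rfloor>"
  shows "\<bar>comb N d b - comb N d a\<bar> \<le> W b - W a"
proof -
  have mono: "\<lfloor>a\<rfloor> \<le> \<lfloor>b\<rfloor>" "\<lfloor>a - d\<rfloor> \<le> \<lfloor>b - d\<rfloor>"
    using assms by (auto intro!: floor_mono)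
  \<comment> \<open>The separating point is the right end \<open>\<lfloor>a\<rfloor> + d\<close> of
    the support containing \<open>a\<close>: it exceeds \<open>a\<close> and is at most
    \<open>a + d \<le> b\<close>.\<close>
  have a: "\<lfloor>a - d\<rfloor> + 1 \<le> \<lfloor>b - d\<rfloor>" if "comb N d a \<noteq> 0"
  proof -
    have "frac a < d"
      using that comb_eq_0[OF \<open>0 < d\<close>, of a N] by linarith
    then have "\<lfloor>a - d\<rfloor> < \<lfloor>a\<rfloor>"
      unfolding floor_less_iff frac_def by linarith
    moreover have "\<lfloor>a\<rfloor> \<le> \<lfloor>b - d\<rfloor>"
      using assms by (intro floor_mono) auto
    ultimately show ?thesis by linarith
  qed
  \<comment> \<open>Here it is the left end \<open>\<lfloor>b\<rfloor>\<close>, because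
    \<open>b - \<lfloor>b\<rfloor> < d \<le> b - a\<close>.\<close>
  have b: "\<lfloor>a\<rfloor> + 1 \<le> \<lfloor>b\<rfloor>" if "comb N d b \<noteq> 0"
  proof -
    have "frac b < d"
      using that comb_eq_0[OF \<open>0 < d\<close>, of b N] by linarith
    then have "\<lfloor>a\<rfloor> < \<lfloor>b\<rfloor>"
      using assms unfolding floor_less_iff frac_def by linarith
    then show ?thesis by linarith
  qed
  show ?thesis
  proof (cases "comb N d a = 0 \<and> comb N d b = 0")
    case True
    then show ?thesis
      using mono by (simp add: W_def)
  next
    case False
    then have "1 \<le> \<lfloor>b\<rfloor> + \<lfloor>b - d\<rfloor> - (\<lfloor>a\<rfloor> + \<lfloor>a - d\<rfloor>)"
      using a b mono by linarith
    then have "1 \<le> W b - W a"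
      unfolding W_def by linarith
    then show ?thesis
      using comb_diff_le_1[of N d b a] by linarith
  qed
qed

section \<open>Sums of comb increments over one period\<close>

text \<open>Both majorants \<open>W\<close> gain a fixed amount \<open>K\<close> per period, so a
  bound by their differences depends neither on the partition nor on the translation
  \<open>c\<close>.\<close>

lemma sum_period_telescope:
  fixes W :: "real \<Rightarrow> real" and t :: "int \<Rightarrow> real"
  assumes "\<And>x. W (x + 1) = W x + K" and "t (int m) = t 0 + 1"
  shows "(\<Sum>i=1..m. W (t (int i)) - W (t (int i - 1))) = K"
proof -
  have "(\<Sum>i=1..n. W (t (int i)) - W (t (int i - 1))) = W (t (int n)) - W (t 0)" for n
    by (induction n) auto
  then show ?thesis
    using assms by simp
qed

lemma comb_sum_increments:
  assumes d: "0 < d" and t: "strict_mono t" "t (int m) = t 0 + 1"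
  shows "(\<Sum>i=1..m. \<bar>comb N d (t (int i) - c) - comb N d (t (int i - 1) - c)\<bar>) \<le> pi * real N"
proof -
  define W where "W x = pi * real N * (real_of_int \<lfloor>x\<rfloor> + min (frac x) d / d)" for x
  have "(\<Sum>i=1..m. \<bar>comb N d (t (int i) - c) - comb N d (t (int i - 1) - c)\<bar>)
      \<le> (\<Sum>i=1..m. W (t (int i) - c) - W (t (int i - 1) - c))"
    unfolding W_def
    by (intro sum_mono comb_increment_le_variation d)
      (use t in \<open>auto simp: strict_mono_less_eq\<close>)
  also have "\<dots> = pi * real N"
    using sum_period_telescope[of W "pi * real N" "\<lambda>i. t i - c" m] t
    by (simp add: W_def frac_1_eq algebra_simps)
  finally show ?thesis .
qed

text \<open>Each period contains one left and one right end of the support, hence the bound 2. It is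
  independent of \<open>N\<close>, which lets the number of teeth be fixed before the width.\<close>

lemma comb_sum_long_increments:
  assumes d: "0 < d" and t: "t (int m) = t 0 + 1"
    and long: "\<And>i. i \<in> {1..m} \<Longrightarrow> d \<le> t (int i) - t (int i - 1)"
  shows "(\<Sum>i=1..m. \<bar>comb N d (t (int i) - c) - comb N d (t (int i - 1) - c)\<bar>) \<le> 2"
proof -
  define W where "W x = real_of_int \<lfloor>x\<rfloor> + real_of_int \<lfloor>x - d\<rfloor>" for x
  have "W (x + 1) = W x + 2" for x
  proof -
    have "x + 1 - d = (x - d) + 1" by simp
    then have "\<lfloor>x + 1 - d\<rfloor> = \<lfloor>x - d\<rfloor> + 1" by (metis floor_add_int of_int_1)
    then show ?thesis by (simp add: W_def)
  qed
  then have W: "(\<Sum>i=1..m. W (t (int i) - c) - W (t (int i - 1) - c)) = 2"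
    using sum_period_telescope[of W 2 "\<lambda>i. t i - c" m] t by simp
  have "(\<Sum>i=1..m. \<bar>comb N d (t (int i) - c) - comb N d (t (int i - 1) - c)\<bar>)
      \<le> (\<Sum>i=1..m. W (t (int i) - c) - W (t (int i - 1) - c))"
    unfolding W_def
    by (intro sum_mono comb_long_increment d) (use long in fastforce)
  with W show ?thesis by simp
qed

section \<open>Translated combs on the unit interval\<close>

text \<open>Replaces \<open>frac\<close>, which jumps at integers, by a clamp, so that continuity on
  the square becomes visible.\<close>

lemma comb_clamp:
  assumes "0 < d" "0 < c" "c + d \<le> 1" "0 \<le> x" "x \<le> 1"
  shows "comb N d (x - c) = \<bar>sin (pi * real N * (max 0 (min (x - c) d) / d))\<bar>"
proof (cases "c \<le> x")
  case True
  then have "frac (x - c) = x - c"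
    using assms by (simp add: frac_eq)
  then show ?thesis
    using True assms by (simp add: comb_def)
next
  case False
  then have "frac (x - c) = x - c + 1"
    using assms by (intro frac_unique_iff[THEN iffD2]) auto
  \<comment> \<open>Left of \<open>c\<close> the fractional part is at least
    \<open>1 - c \<ge> d\<close>, past the support in the preceding period.\<close>
  then have "comb N d (x - c) = 0"
    using assms by (intro comb_eq_0) auto
  moreover have "max 0 (min (x - c) d) = 0"
    using False assms by auto
  ultimately show ?thesis by simp
qed

lemma comb_continuous:
  assumes "0 < d" "0 < c" "c + d \<le> 1"
  shows "continuous_on {0..1} (\<lambda>x. comb N d (x - c))"
proof -
  have "continuous_on {0..1} (\<lambda>x. \<bar>sin (pi * real N * (max 0 (min (x - c) d) / d))\<bar>)"
    using assms by (auto intro!: continuous_intros)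
  then show ?thesis
    by (rule continuous_on_eq) (use assms in \<open>auto simp: comb_clamp\<close>)
qed

lemma comb_outside:
  assumes "0 < d" "0 < c" "c + d \<le> 1" "0 \<le> x" "x \<le> 1" "x \<le> c \<or> c + d \<le> x"
  shows "comb N d (x - c) = 0"
proof -
  have "max 0 (min (x - c) d) = 0 \<or> max 0 (min (x - c) d) = d"
    using assms by auto
  then show ?thesis
    using comb_clamp[OF assms(1-5), of N] assms(1) by (auto simp: mult.commute[of pi])
qed

section \<open>The series of combs on dyadic blocks\<close>

text \<open>Widths that are powers of \<open>1/2\<close> turn the comparison of a block with the
  mesh \<open>(1/2)^n\<close> into one of \<open>r k\<close> with \<open>n\<close>. The weight
  \<open>(1/4)^k\<close> splits into two factors \<open>(1/2)^k\<close> for the upper bound and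
  still loses against \<open>8^k\<close> in the lower bound.\<close>

definition comb_series :: "(nat \<Rightarrow> nat) \<Rightarrow> (nat \<Rightarrow> nat) \<Rightarrow> real \<Rightarrow> real" where
  "comb_series N r x = (\<Sum>k. (1/4)^k * comb (N k) ((1/2)^(r k)) (x - (1/2)^Suc k))"

lemma summable_dominated_geometric:
  fixes u :: "nat \<Rightarrow> real"
  assumes "0 \<le> q" "q < 1" and "\<And>k. \<bar>u k\<bar> \<le> 1"
  shows "summable (\<lambda>k. q^k * u k)"
proof (rule summable_comparison_test')
  show "summable (\<lambda>k. q^k)"
    using assms by (intro summable_geometric) auto
  show "norm (q^k * u k) \<le> q^k" if "k \<ge> 0" for k
    using assms(3)[of k] assms(1) by (simp add: abs_mult mult_left_le)
qed

lemma comb_series_summable: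
  "summable (\<lambda>k. (1/4)^k * comb (N k) ((1/2)^(r k)) (x - (1/2)^Suc k))"
  using comb_nonneg comb_le_1 by (intro summable_dominated_geometric) auto

lemma comb_series_periodic: "comb_series N r (x + 1) = comb_series N r x"
proof -
  have "comb (N k) ((1/2)^(r k)) (x + 1 - c) = comb (N k) ((1/2)^(r k)) (x - c)" for k c
    using comb_periodic[of "N k" "(1/2)^(r k)" "x - c"] by (simp add: algebra_simps)
  then show ?thesis by (simp add: comb_series_def)
qed

lemma comb_series_measurable [measurable]: "comb_series N r \<in> borel_measurable borel"
  unfolding comb_series_def by measurable

lemma half_power_block:
  assumes "k < r"
  shows "(0::real) < (1/2)^r" "(0::real) < (1/2)^Suc k" "(1/2::real)^Suc k + (1/2)^r \<le> (1/2)^k"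
    "(1/2::real)^Suc k + (1/2)^r \<le> 1"
proof -
  have "(1/2::real)^r \<le> (1/2)^Suc k"
    using assms by (intro power_decreasing) auto
  then show *: "(1/2::real)^Suc k + (1/2)^r \<le> (1/2)^k" by simp
  have "(1/2::real)^k \<le> 1" by (simp add: power_le_one)
  with * show "(1/2::real)^Suc k + (1/2)^r \<le> 1" by linarith
qed auto

lemma comb_series_continuous:
  assumes "\<And>k. k < r k"
  shows "continuous_on {0..1} (comb_series N r)"
proof -
  have "uniform_limit {0..1}
      (\<lambda>n x. \<Sum>k<n. (1/4)^k * comb (N k) ((1/2)^(r k)) (x - (1/2)^Suc k))
      (\<lambda>x. \<Sum>k. (1/4)^k * comb (N k) ((1/2)^(r k)) (x - (1/2)^Suc k)) sequentially"
  proof (rule Weierstrass_m_test)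
    show "summable (\<lambda>k. (1/4::real)^k)" by (rule summable_geometric) auto
    show "norm ((1/4)^k * comb (N k) ((1/2)^(r k)) (x - (1/2)^Suc k)) \<le> (1/4)^k" for k x
      by (simp add: abs_mult comb_nonneg comb_le_1)
  qed
  moreover have "continuous_on {0..1}
      (\<lambda>x. \<Sum>k<n. (1/4)^k * comb (N k) ((1/2)^(r k)) (x - (1/2)^Suc k))" for n
    using half_power_block[OF assms]
    by (intro continuous_on_sum continuous_on_mult continuous_on_const comb_continuous) auto
  ultimately show ?thesis
    unfolding comb_series_def by (intro uniform_limit_theorem[OF always_eventually]) auto
qed

text \<open>If \<open>k < r k\<close>, the blocks lie in different dyadic intervals
  \<open>[(1/2)^Suc j, (1/2)^j]\<close>; a shared endpoint is harmless since the combs vanish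
  there.\<close>

lemma comb_series_on_block:
  assumes r: "\<And>k. k < r k" and x: "(1/2)^Suc k \<le> x" "x \<le> (1/2)^Suc k + (1/2)^(r k)"
  shows "comb_series N r x = (1/4)^k * comb (N k) ((1/2)^(r k)) (x - (1/2)^Suc k)"
proof -
  have x01: "0 \<le> x" "x \<le> 1"
    using x half_power_block[OF r[of k]] by linarith+
  have "comb (N j) ((1/2)^(r j)) (x - (1/2)^Suc j) = 0" if "j \<noteq> k" for j
  proof (rule comb_outside)
    show "x \<le> (1/2)^Suc j \<or> (1/2)^Suc j + (1/2)^r j \<le> x"
    proof (cases "j < k")
      case True
      then have "(1/2::real)^k \<le> (1/2)^Suc j"
        by (intro power_decreasing) auto
      then show ?thesis
        using x half_power_block(3)[OF r[of k]] by linarith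
    next
      case False
      then have "(1/2::real)^j \<le> (1/2)^Suc k"
        using that by (intro power_decreasing) auto
      then show ?thesis
        using x half_power_block(3)[OF r[of j]] by linarith
    qed
  qed (use half_power_block[OF r[of j]] x01 in auto)
  then show ?thesis
    unfolding comb_series_def by (subst suminf_finite[of "{k}"]) auto
qed

section \<open>Bounded sharp variation of the series\<close>

text \<open>
  Replaces Minkowski's inequality: with \<open>T = (\<Sum>k. (1/2)^k * u k)\<close>, each \<open>(1/2)^k * u k\<close> lies in \<open>[0, 1]\<close>
  and is at most \<open>T\<close>, hence at most \<open>T powr (1/p)\<close>.
\<close>
lemma geometric_sum_powr_le:
  fixes u :: "nat \<Rightarrow> real"
  assumes u: "\<And>k. 0 \<le> u k" "\<And>k. u k \<le> 1" and p: "1 \<le> p"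
  shows "(\<Sum>k. (1/4)^k * u k) powr p \<le> 2 powr p * (\<Sum>k. (1/2)^k * u k)"
proof -
  define T where "T = (\<Sum>k. (1/2)^k * u k)"
  have u': "\<bar>u k\<bar> \<le> 1" for k using u[of k] by simp
  have sm: "summable (\<lambda>k. (1/2)^k * u k)" "summable (\<lambda>k. (1/4)^k * u k)"
    using u' by (auto intro!: summable_dominated_geometric simp del: power_divide)
  have T: "(1/2)^k * u k \<le> T" for k
    unfolding T_def using sum_le_suminf[OF sm(1), of "{k}"] u by simp
  have T0: "0 \<le> T"
    unfolding T_def using u by (intro suminf_nonneg sm) auto
  have le_T: "(1/2)^k * u k \<le> T powr (1/p)" for k
  proof -
    have a: "0 \<le> (1/2)^k * u k" "(1/2)^k * u k \<le> 1"
      using u[of k] by (auto intro!: mult_le_one power_le_one)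
    have "((1/2)^k * u k) powr 1 \<le> ((1/2)^k * u k) powr (1/p)"
      using a p by (intro powr_mono') auto
    also have "\<dots> \<le> T powr (1/p)"
      using a T p by (intro powr_mono2) auto
    finally show ?thesis using a by simp
  qed
  have "(\<Sum>k. (1/4)^k * u k) \<le> (\<Sum>k. T powr (1/p) * (1/2)^k)"
  proof (rule suminf_le)
    fix k
    \<comment> \<open>One factor \<open>(1/2)^k\<close> goes into the bound by
      \<open>T powr (1/p)\<close>; the other makes the sum over \<open>k\<close> converge, to
      2.\<close>
    have "(1/4)^k * u k = (1/2)^k * ((1/2)^k * u k)"
      by (simp add: mult.assoc[symmetric] flip: power_mult_distrib)
    also have "\<dots> \<le> (1/2)^k * T powr (1/p)"
      using le_T by (intro mult_left_mono) auto
    finally show "(1/4)^k * u k \<le> T powr (1/p) * (1/2)^k" by (simp only: mult.commute)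
  qed (use sm in \<open>auto intro!: summable_mult summable_geometric simp del: power_divide\<close>)
  also have "\<dots> = 2 * T powr (1/p)"
    by (simp add: suminf_mult suminf_geometric summable_geometric del: power_divide)
  finally have "(\<Sum>k. (1/4)^k * u k) powr p \<le> (2 * T powr (1/p)) powr p"
    using p u sm by (intro powr_mono2 suminf_nonneg) auto
  also have "\<dots> = 2 powr p * T"
    using p T0 by (simp add: powr_mult powr_powr)
  finally show ?thesis by (simp add: T_def)
qed

text \<open>Once the \<open>p\<close>-th power is moved inside the sum over \<open>k\<close>, the
  array \<open>u i k\<close> enters linearly, so the sums can be exchanged and only the column sums
  over \<open>i\<close> need bounding.\<close>

lemma comb_series_partition_bound:
  assumes t: "strict_mono t" "t (int m) = t 0 + 1"
    and fine: "\<And>i. i \<in> {1..m} \<Longrightarrow> (1/2)^n \<le> t (int i) - t (int i - 1)"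
    and p: "1 \<le> p" and N: "\<And>k. r k \<le> n \<Longrightarrow> pi * real (N k) \<le> 2 powr p"
  shows "(\<Sum>i=1..m. \<bar>comb_series N r (t (int i)) - comb_series N r (t (int i - 1))\<bar> powr p) powr (1/p)
    \<le> 8"
proof -
  define h where "h k x = comb (N k) ((1/2)^(r k)) (x - (1/2)^Suc k)" for k x
  define u where "u i k = \<bar>h k (t (int i)) - h k (t (int i - 1))\<bar>" for i k
  have u: "0 \<le> u i k" "u i k \<le> 1" for i k
    using comb_diff_le_1 by (auto simp: u_def h_def)
  have sm: "summable (\<lambda>k. (1/2)^k * u i k)" "summable (\<lambda>k. (1/4)^k * u i k)" for i
    using u by (auto intro!: summable_dominated_geometric simp del: power_divide)
  have smh: "summable (\<lambda>k. (1/4)^k * h k x)" for x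
    unfolding h_def by (rule comb_series_summable)
  have incr: "\<bar>comb_series N r (t (int i)) - comb_series N r (t (int i - 1))\<bar> \<le> (\<Sum>k. (1/4)^k * u i k)"
    for i
  proof -
    have eq: "norm ((1/4)^k * h k (t (int i)) - (1/4)^k * h k (t (int i - 1))) = (1/4)^k * u i k" for k
      by (simp add: u_def abs_mult flip: right_diff_distrib)
    have "comb_series N r (t (int i)) - comb_series N r (t (int i - 1))
        = (\<Sum>k. (1/4)^k * h k (t (int i)) - (1/4)^k * h k (t (int i - 1)))"
      unfolding comb_series_def h_def[symmetric] by (rule suminf_diff[OF smh smh])
    then show ?thesis
      using summable_norm[of "\<lambda>k. (1/4)^k * h k (t (int i)) - (1/4)^k * h k (t (int i - 1))"] sm(2)[of i]
      unfolding eq by simp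
  qed
  have col: "(\<Sum>i=1..m. u i k) \<le> 2 powr p" for k
  proof (cases "r k \<le> n")
    case True
    have "(\<Sum>i=1..m. u i k) \<le> pi * real (N k)"
      unfolding u_def h_def using t by (intro comb_sum_increments) auto
    then show ?thesis using N[OF True] by linarith
  next
    case False
    then have "(1/2::real)^(r k) \<le> (1/2)^n"
      by (intro power_decreasing) auto
    then have "(1/2)^(r k) \<le> t (int i) - t (int i - 1)" if "i \<in> {1..m}" for i
      using fine[OF that] by linarith
    then have "(\<Sum>i=1..m. u i k) \<le> 2"
      unfolding u_def h_def using t by (intro comb_sum_long_increments) auto
    also have "2 \<le> 2 powr p"
      using p powr_mono[of 1 p "2::real"] by simp
    finally show ?thesis .
  qed
  have "(\<Sum>i=1..m. \<bar>comb_series N r (t (int i)) - comb_series N r (t (int i - 1))\<bar> powr p)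
      \<le> (\<Sum>i=1..m. (\<Sum>k. (1/4)^k * u i k) powr p)"
    using incr p by (intro sum_mono powr_mono2) auto
  also have "\<dots> \<le> (\<Sum>i=1..m. 2 powr p * (\<Sum>k. (1/2)^k * u i k))"
    using u p by (intro sum_mono geometric_sum_powr_le) auto
  also have "\<dots> = 2 powr p * (\<Sum>k. \<Sum>i=1..m. (1/2)^k * u i k)"
    using sm by (simp add: suminf_sum sum_distrib_left)
  also have "\<dots> \<le> 2 powr p * (\<Sum>k. 2 powr p * (1/2)^k)"
  proof (intro mult_left_mono suminf_le)
    show "(\<Sum>i=1..m. (1/2)^k * u i k) \<le> 2 powr p * (1/2)^k" for k
      using mult_left_mono[OF col[of k], of "(1/2)^k"]
      by (simp add: sum_distrib_left mult.commute del: power_divide)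
  qed (use sm in \<open>auto intro!: summable_sum summable_mult summable_geometric simp del: power_divide\<close>)
  also have "\<dots> = 2 powr p * (2 powr p * 2)"
    by (simp add: suminf_mult suminf_geometric summable_geometric del: power_divide)
  \<comment> \<open>The geometric sum 2 is enlarged to \<open>2 powr p\<close>, so that three equal
    factors combine into \<open>8 powr p\<close>, whose \<open>p\<close>-th root is 8.\<close>
  also have "\<dots> \<le> 2 powr p * (2 powr p * 2 powr p)"
    using p powr_mono[of 1 p "2::real"] by simp
  also have "\<dots> = 8 powr p"
    by (simp flip: powr_mult)
  finally have "(\<Sum>i=1..m. \<bar>comb_series N r (t (int i)) - comb_series N r (t (int i - 1))\<bar> powr p) powr (1/p)
      \<le> (8 powr p) powr (1/p)"
    using p by (intro powr_mono2) (auto intro: sum_nonneg)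
  then show ?thesis
    using p by (simp add: powr_powr)
qed

section \<open>Lower bound for the Lambda-variation\<close>

text \<open>The \<open>i\<close>-th hump starts from zero at phase \<open>i - 1\<close> and peaks at
  phase \<open>i - 1/2\<close> (in units of \<open>pi\<close>), so its rising half realizes the full
  height.\<close>

lemma comb_series_tooth:
  assumes r: "\<And>k. k < r k" and i: "1 \<le> i" "i \<le> N k"
  defines "c \<equiv> (1/2)^Suc k" and "d \<equiv> (1/2)^(r k)"
  shows "comb_series N r (c + (real i - 1/2) / real (N k) * d)
    - comb_series N r (c + (real i - 1) / real (N k) * d) = (1/4)^k"
proof -
  have d: "0 < d" and d1: "d \<le> 1" by (auto simp: d_def power_le_one)
  have val: "comb_series N r (c + s / real (N k) * d) = (1/4)^k * \<bar>sin (pi * s)\<bar>"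
    if s: "0 \<le> s" "s < real (N k)" for s
  proof -
    have "s / real (N k) * d < 1 * d"
      using s d by (intro mult_strict_right_mono) auto
    then have le: "s / real (N k) * d < d" by simp
    have ge: "0 \<le> s / real (N k) * d"
      using s d by auto
    have "frac (s / real (N k) * d) = s / real (N k) * d"
      using le ge d1 by (simp add: frac_eq)
    then have "comb (N k) d (s / real (N k) * d) = \<bar>sin (pi * s)\<bar>"
      using le d s by (simp add: comb_def)
    moreover have "comb_series N r (c + s / real (N k) * d) = (1/4)^k * comb (N k) d (s / real (N k) * d)"
      using comb_series_on_block[of r k "c + s / real (N k) * d" N, OF r] le ge
      by (simp add: c_def d_def)
    ultimately show ?thesis by simp
  qed
  have "pi * (real i - 1/2) = pi * (real (i - 1)) + pi/2"
    using i by (simp add: of_nat_diff algebra_simps)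
  then have "\<bar>sin (pi * (real i - 1/2))\<bar> = \<bar>cos (pi * real (i - 1))\<bar>"
    by (simp add: sin_add)
  then have 1: "\<bar>sin (pi * (real i - 1/2))\<bar> = 1"
    by (simp add: mult.commute[of pi] power_abs)
  have "\<bar>sin (pi * real (i - 1))\<bar> = 0"
    by (simp add: mult.commute[of pi])
  then have 2: "\<bar>sin (pi * (real i - 1))\<bar> = 0"
    using i by (simp add: of_nat_diff)
  show ?thesis
    using val[of "real i - 1/2"] val[of "real i - 1"] 1 2 i by simp
qed

lemma comb_series_Lambda_V1:
  assumes r: "\<And>k. k < r k" and lam: "\<And>i. 1 \<le> i \<Longrightarrow> 0 < lam i"
  shows "ennreal ((1/4)^k * (\<Sum>i=1..N k. 1 / lam i)) \<le> Lambda_V1 lam (\<lambda>z. comb_series N r (fst z))"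
proof -
  define c d :: real where "c = (1/2)^Suc k" and "d = (1/2)^(r k)"
  have d: "0 < d" "0 < c" "c + d \<le> 1"
    using half_power_block[OF r[of k]] by (auto simp: c_def d_def)
  \<comment> \<open>\<open>J i\<close> is the rising half of the \<open>i\<close>-th hump; the
    falling halves keep these intervals apart. All increments are equal, so the sum is a multiple of
    a partial sum of \<open>1 / lam i\<close>.\<close>
  define J where "J i = (c + (real i - 1) / real (N k) * d, c + (real i - 1/2) / real (N k) * d)" for i
  have disj: "{fst (J i)<..<snd (J i)} \<inter> {fst (J j)<..<snd (J j)} = {}" if "i < j" for i j
  proof -
    have "(real i - 1/2) / real (N k) * d \<le> (real j - 1) / real (N k) * d"
      using that d by (intro mult_right_mono divide_right_mono) auto
    then show ?thesis by (auto simp: J_def)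
  qed
  have J: "0 \<le> fst (J i) \<and> fst (J i) < snd (J i) \<and> snd (J i) \<le> 1" if i: "i \<in> {1..N k}" for i
  proof (intro conjI)
    show "0 \<le> fst (J i)" using i d by (auto simp: J_def)
    show "fst (J i) < snd (J i)"
      using i d by (auto simp: J_def intro!: divide_strict_right_mono)
    have "(real i - 1/2) / real (N k) * d \<le> 1 * d"
      using i d by (intro mult_right_mono) auto
    then show "snd (J i) \<le> 1" using d by (simp add: J_def)
  qed
  have "{fst (J i)<..<snd (J i)} \<inter> {fst (J j)<..<snd (J j)} = {}" if "i \<noteq> j" for i j
    using disj[of i j] disj[of j i] that by (cases "i < j") auto
  then have "({1..N k}, J) \<in> interval_collections"
    unfolding interval_collections_def using J by blast
  moreover have "(\<lambda>_. 0) \<in> unit_sequences"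
    by (auto simp: unit_sequences_def)
  ultimately have "(\<Sum>\<^sub>\<infinity>i\<in>{1..N k}. ennreal (\<bar>incr1 (\<lambda>z. comb_series N r (fst z)) (J i) 0\<bar> / lam i))
      \<le> Lambda_V1 lam (\<lambda>z. comb_series N r (fst z))"
    unfolding Lambda_V1_def by (intro SUP_upper2[of "\<lambda>_. 0"] SUP_upper2[of "({1..N k}, J)"]) auto
  moreover have "\<bar>incr1 (\<lambda>z. comb_series N r (fst z)) (J i) 0\<bar> = (1/4)^k" if "i \<in> {1..N k}" for i
    using comb_series_tooth[of r i N k, OF r] that by (simp add: incr1_def J_def c_def d_def)
  then have "(\<Sum>\<^sub>\<infinity>i\<in>{1..N k}. ennreal (\<bar>incr1 (\<lambda>z. comb_series N r (fst z)) (J i) 0\<bar> / lam i))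
      = (\<Sum>i\<in>{1..N k}. ennreal ((1/4)^k / lam i))"
    by (simp add: infsum_finite)
  moreover have "\<dots> = ennreal (\<Sum>i\<in>{1..N k}. (1/4)^k / lam i)"
    using lam by (intro sum_ennreal) (auto simp: less_imp_le)
  ultimately show ?thesis
    by (simp add: sum_distrib_left del: power_divide)
qed

section \<open>Choice of the teeth and widths, and the two membership claims\<close>

theorem theorem4:
  fixes lam p :: "nat \<Rightarrow> real"
  assumes "1 < lam 1"
    and "mono_on {1..} lam"
    and "filterlim lam at_top sequentially"
    and "filterlim (\<lambda>N. \<Sum>n=1..N. 1 / lam n) at_top sequentially"
    and "mono_on {1..} p"
    and "\<forall>n\<ge>1. 1 \<le> p n"
    and "filterlim p at_top sequentially"
  shows "\<exists>f. f \<in> BV_sharp p \<inter> continuous_on_square \<and> f \<notin> Lambda_BV lam"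
proof -
  have lam: "0 < lam i" if "1 \<le> i" for i
    using mono_onD[OF assms(2), of 1 i] assms(1) that by simp
  have "\<exists>M. 8^k \<le> (\<Sum>n=1..M. 1 / lam n)" for k :: nat
    using assms(4) unfolding filterlim_at_top by (meson eventually_sequentially order_refl)
  then obtain N where N: "8^k \<le> (\<Sum>n=1..N k. 1 / lam n)" for k :: nat
    by metis
  have "\<exists>s>k. pi * real (N k) \<le> 2 powr p s" for k
  proof -
    \<comment> \<open>The maximum with 1 keeps the argument of the logarithm positive;
      \<open>Suc k\<close> below ensures \<open>k < r k\<close>.\<close>
    obtain s0 where s0: "\<And>s. s0 \<le> s \<Longrightarrow> log 2 (max 1 (pi * real (N k))) \<le> p s"
      using assms(7) unfolding filterlim_at_top eventually_sequentially by metis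
    have "pi * real (N k) \<le> 2 powr log 2 (max 1 (pi * real (N k)))"
      by simp
    also have "\<dots> \<le> 2 powr p (max s0 (Suc k))"
      using s0 by (intro powr_mono) auto
    finally show ?thesis
      by (intro exI[of _ "max s0 (Suc k)"]) auto
  qed
  then obtain r where r: "\<And>k. k < r k" and Nr: "\<And>k. pi * real (N k) \<le> 2 powr p (r k)"
    by metis
  define f :: "real \<times> real \<Rightarrow> real" where "f = (\<lambda>z. comb_series N r (fst z))"
  have per: "f \<in> periodic_functions"
  proof -
    have "f \<in> borel_measurable borel"
      unfolding f_def by (rule measurable_compose[OF borel_measurable_continuous_onI comb_series_measurable])
        (auto intro!: continuous_intros)
    then have "f \<in> borel_measurable lebesgue"
      by (simp add: measurable_completion)
    then show ?thesis
      by (simp add: periodic_functions_def f_def comb_series_periodic)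
  qed
  have cont: "f \<in> continuous_on_square"
  proof -
    have "continuous_on ({0..1} \<times> {0..1}) f"
      unfolding f_def
      by (rule continuous_on_compose2[OF comb_series_continuous[OF r] continuous_on_fst[OF continuous_on_id]])
        auto
    then show ?thesis
      using per by (simp add: continuous_on_square_def)
  qed
  have "V1_sharp p f \<le> 8"
    unfolding V1_sharp_def
  proof (intro SUP_least, clarify)
    fix y n t m assume n: "1 \<le> n" and tm: "(t, m) \<in> fine_partitions n"
    have t: "strict_mono t" "1 \<le> m" "t (int m) = t 0 + 1"
      using tm by (auto simp: fine_partitions_def periodic_partitions_def dest: spec[of _ 0])
    have fine: "(1/2)^n \<le> t (int i) - t (int i - 1)" if "i \<in> {1..m}" for i
    proof -
      have "(1/2::real)^n \<le> (INF i\<in>{1..m}. t (int i) - t (int i - 1))"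
        using tm by (simp add: fine_partitions_def partition_interval_def power_divide)
      also have "\<dots> \<le> t (int i) - t (int i - 1)"
        using that by (intro cINF_lower) auto
      finally show ?thesis .
    qed
    \<comment> \<open>Monotonicity of \<open>p\<close> carries the inequality chosen at level
      \<open>r k\<close> to every finer level \<open>n\<close>; \<open>r k > k\<close> puts the
      index in the range \<open>{1..}\<close>.\<close>
    have "pi * real (N k) \<le> 2 powr p n" if "r k \<le> n" for k
    proof -
      have "p (r k) \<le> p n"
        using that r[of k] by (intro mono_onD[OF assms(5)]) auto
      then show ?thesis
        using Nr[of k] powr_mono[of "p (r k)" "p n" "2::real"] by linarith
    qed
    then have "(\<Sum>i=1..m. \<bar>comb_series N r (t (int i)) - comb_series N r (t (int i - 1))\<bar> powr p n)
        powr (1 / p n) \<le> 8"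
      using t fine n assms(6) by (intro comb_series_partition_bound) auto
    from ennreal_leI[OF this]
    show "ennreal ((\<Sum>i=1..m. \<bar>incr1 f (partition_interval t i) (y i)\<bar> powr p n) powr (1 / p n)) \<le> 8"
      by (simp add: incr1_def partition_interval_def f_def)
  qed
  then have "V1_sharp p f < \<infinity>"
    using ennreal_numeral_less_top order_le_less_trans by (metis infinity_ennreal_def)
  \<comment> \<open>\<open>f\<close> is constant in the second variable, and
    \<open>0 powr a = 0\<close> for every \<open>a\<close>.\<close>
  moreover have "V2_sharp p f \<le> 0"
    unfolding V2_sharp_def by (intro SUP_least) (auto simp: incr2_def f_def)
  ultimately have BV: "f \<in> BV_sharp p"
    using per by (simp add: BV_sharp_def)
  have "f \<notin> Lambda_BV lam"
  proof
    assume "f \<in> Lambda_BV lam"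
    then have "Lambda_V1 lam f < \<infinity>"
      by (auto simp: Lambda_BV_def intro: order_le_less_trans[rotated])
    then obtain C where C: "Lambda_V1 lam f = ennreal C" "0 \<le> C"
      by (cases "Lambda_V1 lam f") auto
    \<comment> \<open>The \<open>k\<close>-th comb alone contributes at least
      \<open>(1/4)^k * 8^k\<close>, which is unbounded in \<open>k\<close>.\<close>
    have "2^k \<le> C" for k :: nat
    proof -
      have "(2::real)^k = (1/4)^k * 8^k"
        by (simp flip: power_mult_distrib)
      also have "\<dots> \<le> (1/4)^k * (\<Sum>i=1..N k. 1 / lam i)"
        using N[of k] by (intro mult_left_mono) auto
      also have "\<dots> \<le> C"
        using comb_series_Lambda_V1[of r lam k N, OF r lam] C
        unfolding f_def by (simp only: ennreal_le_iff)
      finally show ?thesis .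
    qed
    moreover obtain k :: nat where "C < 2^k"
      using real_arch_pow[of 2 C] by auto
    ultimately show False by (meson not_le)
  qed
  with BV cont show ?thesis by auto
qed

end
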